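(* Let $k\ge1$, $m\ge0$, let $n_1,\dots,n_k$ be pairwise relatively prime positive integers, put $s=n_1+\cdots+n_k$, and let $p(x)\in\mathbb{Q}[x]$ be a nonzero polynomial of degree $d<s+m$ that is palindromic in the sense that $p(1/x)=(-1)^{\delta}x^{-d}p(x)$ for some integer $\delta$. Then for every integer $n$ with $1\le n\le s+m-d-1$, $$\sum_{j=1}^{k}S_n(n_1,\dots,\widehat{n_j},\dots,n_k;\,n_j)=-\mathrm{poly}(-n).$$
   Context: The hat means that the corresponding entry is omitted. For a positive integer $b$ coprime to integers $m_1,\dots,m_r$ ($r\ge0$) and $t\in\mathbb{Z}$, the generalized Fourier–Dedekind sum (attached to $p$ and $m$) is $$S_t(m_1,\dots,m_r;b)=\frac1b\sum_{i=1}^{b-1}\frac{p(\xi^i)\,\xi^{it}}{(1-\xi^i)^m(1-\xi^{im_1})\cdots(1-\xi^{im_r})},\qquad \xi=e^{2\pi i/b}$$ (in the exponent of $e$, $i=\sqrt{-1}$); for $r=0$ the product over the $m_l$ is empty. For $n\ge1$, $\Psi_n(x)=1+x+\cdots+x^{n-1}$, and $f^{(n)}_j(x)=\big(-\tfrac1n x\Psi_n'(x)\big)^j\ \mathrm{rem}\ \Psi_n(x)$ for $j\ge1$, $f^{(n)}_0(x)=1$, where $f\ \mathrm{rem}\ q$ is the remainder of $f$ on Euclidean division by $q$. Write $p(x)=\sum_{i\ge0}a_i(1-x)^i$. For $0\le j\le m+k-1$ put $$c_j=\frac{1}{n_1\cdots n_k}\sum_{i+i_1+\cdots+i_k=j}a_i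 f^{(n_1)}_{i_1}(1)\cdots f^{(n_k)}_{i_k}(1)$$ (sum over non-negative integers), and let $\mathrm{poly}$ be the polynomial $$\mathrm{poly}(n)=\sum_{j=0}^{m+k-1}c_j\binom{n+m+k-j-1}{m+k-j-1},$$ where $\binom{n+l-1}{l-1}=\frac{(n+1)(n+2)\cdots(n+l-1)}{(l-1)!}$ is regarded as a polynomial in $n$ (so it may be evaluated at negative integers). *)

theory Defs
  imports Complex_Main "HOL-Library.FuncSet" "HOL-Computational_Algebra.Polynomial"
begin

text \<open>
  \<open>fourier_dedekind p m t I ms b\<close> is $S_t(m_1,\dots,m_r;b)$, where the arguments
  $m_1,\dots,m_r$ are given as a family \<open>ms\<close> over a finite index set \<open>I\<close>, so that omitting
  an entry amounts to removing its index from \<open>I\<close>. It is meant for \<open>b > 0\<close> coprime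
  to all \<open>ms l\<close>; the denominators are then non-zero.
\<close>
definition fourier_dedekind ::
    "rat poly \<Rightarrow> nat \<Rightarrow> int \<Rightarrow> nat set \<Rightarrow> (nat \<Rightarrow> int) \<Rightarrow> nat \<Rightarrow> complex" where
  "fourier_dedekind p m t I ms b =
     (let \<xi> = exp (2 * of_real pi * \<i> / of_nat b) in
      1 / of_nat b * (\<Sum>i = 1..b - 1.
        poly (map_poly of_rat p) (\<xi> ^ i) * \<xi> powi (int i * t) /
        ((1 - \<xi> ^ i) ^ m * (\<Prod>l\<in>I. 1 - \<xi> powi (int i * ms l)))))"

definition Psi :: "nat \<Rightarrow> rat poly" where
  "Psi n = (\<Sum>i<n. monom 1 i)"

definition f_poly :: "nat \<Rightarrow> nat \<Rightarrow> rat poly" where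
  "f_poly n j =
     (if j = 0 then 1
      else (smult (- 1 / of_nat n) ([:0, 1:] * pderiv (Psi n))) ^ j mod Psi n)"

text \<open>The coefficients $a_i$ of the expansion $p(x) = \sum_i a_i (1-x)^i$.\<close>
definition a_coeff :: "rat poly \<Rightarrow> nat \<Rightarrow> rat" where
  "a_coeff p i = coeff (pcompose p [:1, - 1:]) i"

lemma a_coeff_expansion: "p = (\<Sum>i\<le>degree p. smult (a_coeff p i) ([:1, - 1:] ^ i))"
proof -
  let ?l = "[:1, - 1:] :: rat poly"
  let ?q = "pcompose p ?l"
  have deg: "degree ?q = degree p"
    by (simp add: degree_pcompose)
  have ll: "pcompose ?l ?l = [:0, 1:]"
    by (simp add: pcompose_pCons)
  have pow: "pcompose ([:0, 1:] ^ i) ?l = ?l ^ i" for i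
    by (induction i) (simp_all add: pcompose_mult pcompose_pCons pcompose_1)
  have "p = pcompose ?q ?l"
    using pcompose_assoc[of p ?l ?l] ll by simp
  also have "\<dots> = pcompose (\<Sum>i\<le>degree ?q. monom (coeff ?q i) i) ?l"
    by (simp add: poly_as_sum_of_monoms)
  also have "\<dots> = (\<Sum>i\<le>degree p. smult (a_coeff p i) (?l ^ i))"
    by (simp add: pcompose_sum deg a_coeff_def monom_altdef pcompose_smult pow)
  finally show ?thesis .
qed

text \<open>A tuple $(i, i_1, \dots, i_k)$ is encoded as \<open>(i, e)\<close> with $e(l) = i_l$.\<close>
definition compositions :: "nat \<Rightarrow> nat \<Rightarrow> (nat \<times> (nat \<Rightarrow> nat)) set" where
  "compositions k j = {(i, e). e \<in> {1..k} \<rightarrow>\<^sub>E UNIV \<and> i + (\<Sum>l = 1..k. e l) = j}"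

lemma finite_compositions: "finite (compositions k j)"
proof (rule finite_subset)
  show "compositions k j \<subseteq> {..j} \<times> ({1..k} \<rightarrow>\<^sub>E {..j})"
  proof
    fix x assume x: "x \<in> compositions k j"
    obtain i e where xe: "x = (i, e)" by (cases x)
    have e: "e \<in> {1..k} \<rightarrow>\<^sub>E UNIV" and j: "i + (\<Sum>l = 1..k. e l) = j"
      using x by (auto simp: compositions_def xe)
    have "e l \<le> j" if "l \<in> {1..k}" for l
      using member_le_sum[of l "{1..k}" e] that j by simp
    then show "x \<in> {..j} \<times> ({1..k} \<rightarrow>\<^sub>E {..j})"
      using e j by (auto simp: xe PiE_iff)
  qed
  show "finite ({..j} \<times> ({1..k} \<rightarrow>\<^sub>E {..j}))"
    by (intro finite_cartesian_product finite_PiE) auto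
qed

definition c_coeff :: "rat poly \<Rightarrow> nat \<Rightarrow> (nat \<Rightarrow> nat) \<Rightarrow> nat \<Rightarrow> rat" where
  "c_coeff p k ns j =
     1 / of_nat (\<Prod>l = 1..k. ns l) *
     (\<Sum>(i, e)\<in>compositions k j. a_coeff p i * (\<Prod>l = 1..k. poly (f_poly (ns l) (e l)) 1))"

text \<open>The binomial coefficient $\binom{n+q}{q}$ as a polynomial in $n$.\<close>
definition binomial_poly :: "nat \<Rightarrow> rat poly" where
  "binomial_poly q = smult (1 / fact q) (\<Prod>i = 1..q. [:of_nat i, 1:])"

definition poly_part :: "rat poly \<Rightarrow> nat \<Rightarrow> nat \<Rightarrow> (nat \<Rightarrow> nat) \<Rightarrow> rat poly" where
  "poly_part p m k ns =
     (\<Sum>j = 0..m + k - 1. smult (c_coeff p k ns j) (binomial_poly (m + k - j - 1)))"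

text \<open>
  $p(1/x) = (-1)^\delta x^{-d} p(x)$ with \<open>d = degree p\<close>. As the rationals are infinite, the
  identity of rational functions may be stated pointwise.
\<close>
definition palindromic :: "rat poly \<Rightarrow> bool" where
  "palindromic p \<longleftrightarrow>
     (\<exists>\<delta>::int. \<forall>x::rat. x \<noteq> 0 \<longrightarrow>
        poly p (1 / x) = (- 1) powi \<delta> * x powi (- int (degree p)) * poly p x)"

end

theory Submission
  imports Defs "HOL-Computational_Algebra.Polynomial_FPS" "HOL-Number_Theory.Cong"
begin

text \<open>
  The residues of
  $$\frac{x^{n-1}p(x)}{(1-x)^m\prod_l(1-x^{n_l})} = \frac{x^{n-1}p(x)}{(1-x)^{m+k}\prod_l\Psi_{n_l}(x)}$$
  sum to zero when $n \le s+m-d-1$, because the degree of the numerator is then at most that of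
  the denominator minus 2. By coprimality the poles other than 1 are simple, and their residues are
  the negatives of the terms of the sums $S_n$. As $c_j$ is the coefficient of $(1-x)^j$ in
  $p/\prod_l\Psi_{n_l}$, the coefficient of $(1-x)^{m+k-1}$ in $x^{n-1}p/\prod_l\Psi_{n_l}$ is
  $\mathrm{poly}(-n)$, which up to sign is the residue at 1. All polynomials are rewritten in the
  variable $1-x$ by \<open>flip_poly\<close>.
\<close>

unbundle fps_syntax

section \<open>Coefficients of products of power series as sums over compositions\<close>

text \<open>Induction on \<open>k\<close> by splitting off the last factor with the Cauchy product.
  It serves to read the definition of \<open>c_coeff\<close> as a coefficient of a product of
  series.\<close>

lemma coeff_fps_prod_compositions:
  fixes a :: "rat fps" and b :: "nat \<Rightarrow> rat fps"
  shows "(a * (\<Prod>l = 1..k. b l)) $ j =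
    (\<Sum>(i, e)\<in>compositions k j. a $ i * (\<Prod>l = 1..k. b l $ e l))"
proof (induction k arbitrary: j)
  case 0
  have "compositions 0 j = {(j, \<lambda>_. undefined)}"
    by (auto simp: compositions_def)
  then show ?case by simp
next
  case (Suc k)
  have "(a * (\<Prod>l = 1..Suc k. b l)) $ j = ((a * (\<Prod>l = 1..k. b l)) * b (Suc k)) $ j"
    by (simp add: mult_ac)
  also have "\<dots> = (\<Sum>q\<in>{0..j}. (a * (\<Prod>l = 1..k. b l)) $ q * b (Suc k) $ (j - q))"
    by (simp add: fps_mult_nth)
  also have "\<dots> = (\<Sum>q\<in>{0..j}. \<Sum>x\<in>compositions k q.
      a $ fst x * (\<Prod>l = 1..k. b l $ snd x l) * b (Suc k) $ (j - q))"
    by (simp add: Suc.IH sum_distrib_right case_prod_unfold del: One_nat_def)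
  also have "\<dots> = (\<Sum>(q, x)\<in>(SIGMA q:{0..j}. compositions k q).
      a $ fst x * (\<Prod>l = 1..k. b l $ snd x l) * b (Suc k) $ (j - q))"
    by (subst sum.Sigma) (auto intro: finite_compositions)
  also have "\<dots> = (\<Sum>(i, e)\<in>compositions (Suc k) j. a $ i * (\<Prod>l = 1..Suc k. b l $ e l))"
  \<comment> \<open>The last entry is forced to be \<open>j - q\<close>. Resetting it to
    \<open>undefined\<close> restores extensionality on \<open>{1..k}\<close>, so the two maps are
    mutually inverse.\<close>
  proof (rule sum.reindex_bij_witness[where
        i = "\<lambda>(i, e). (j - e (Suc k), (i, e(Suc k := undefined)))" and
        j = "\<lambda>(q, (i, e)). (i, e(Suc k := j - q))"], goal_cases)
    case (1 x)
    then show ?case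
      by (auto simp: compositions_def PiE_iff extensional_def fun_eq_iff)
  next
    case (2 x)
    have "(\<Sum>l = 1..k. (if l = Suc k then c else e l)) = (\<Sum>l = 1..k. e l)" for e :: "nat \<Rightarrow> nat" and c
      by (intro sum.cong) auto
    with 2 show ?case
      by (auto simp: compositions_def PiE_iff extensional_def)
  next
    case (3 x)
    then show ?case
      by (auto simp: compositions_def fun_eq_iff)
  next
    case (4 x)
    have "(\<Sum>l = 1..k. (if l = Suc k then c else e l)) = (\<Sum>l = 1..k. e l)" for e :: "nat \<Rightarrow> nat" and c
      by (intro sum.cong) auto
    with 4 show ?case
      by (auto simp: compositions_def PiE_iff extensional_def)
  next
    case (5 x)
    have "(\<Prod>l = 1..k. b l $ (if l = Suc k then c else e l)) = (\<Prod>l = 1..k. b l $ e l)" for e c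
      by (intro prod.cong) auto
    with 5 show ?case
      by (auto simp: case_prod_unfold mult_ac)
  qed
  finally show ?case .
qed

lemma coeff_Psi: "coeff (Psi n) i = (if i < n then 1 else 0)"
  by (simp add: Psi_def coeff_sum)

lemma degree_Psi: "degree (Psi n) = n - 1"
proof (cases n)
  case 0
  then show ?thesis by (simp add: Psi_def)
next
  case (Suc m)
  show ?thesis
    by (rule antisym[OF degree_le le_degree]) (auto simp: coeff_Psi Suc)
qed

lemma poly_Psi_1: "poly (Psi n) 1 = of_nat n"
  by (simp add: Psi_def poly_sum poly_monom)

lemma Psi_neq_0: "n > 0 \<Longrightarrow> Psi n \<noteq> 0"
  by (metis poly_Psi_1 poly_0 of_nat_0_eq_iff less_numeral_extra(3))

lemma linear_mult_Psi: "[:1, -1:] * Psi n = 1 - [:0, 1:] ^ n"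
proof (induction n)
  case (Suc n)
  have "Psi (Suc n) = Psi n + [:0, 1:] ^ n"
    by (simp add: Psi_def monom_altdef)
  then show ?case
    using Suc by (simp add: algebra_simps)
qed (simp add: Psi_def)

lemma linear_inverse_mod_Psi:
  assumes "n > 0"
  shows "Psi n dvd [:1, -1:] * smult (- 1 / of_nat n) ([:0, 1:] * pderiv (Psi n)) - 1"
proof -
  obtain k where n: "n = Suc k"
    using assms gr0_conv_Suc by blast
  let ?X = "[:0, 1:] :: rat poly"
  have "pderiv ([:1, -1:] * Psi n) = pderiv (1 - ?X ^ n)"
    by (simp only: linear_mult_Psi)
  then have "[:1, -1:] * pderiv (Psi n) - Psi n = - smult (of_nat n) (?X ^ k)"
    unfolding pderiv_mult pderiv_diff n pderiv_power_Suc
    by (simp add: pderiv_pCons algebra_simps)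
  then have "?X * ([:1, -1:] * pderiv (Psi n)) - ?X * Psi n = - smult (of_nat n) (?X ^ n)"
    unfolding n by (metis (no_types, lifting) mult_minus_right mult_smult_right power_Suc right_diff_distrib)
  also have "?X ^ n = 1 - [:1, -1:] * Psi n"
    unfolding linear_mult_Psi by simp
  finally have *: "[:1, -1:] * (?X * pderiv (Psi n)) =
      ?X * Psi n - smult (of_nat n) (1 - [:1, -1:] * Psi n)"
    by (simp only: mult.left_commute diff_eq_eq)
  have "[:1, -1:] * smult (- 1 / of_nat n) (?X * pderiv (Psi n)) - 1 =
      Psi n * (smult (- 1 / of_nat n) ?X - [:1, -1:])"
  proof -
    have "smult (- 1 / of_nat n) (A - smult (of_nat n) (1 - B)) - 1 = smult (- 1 / of_nat n) A - B"
      for A B :: "rat poly"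
      using assms by (simp add: smult_diff_right)
    then show ?thesis
      unfolding mult_smult_right * by (simp only: right_diff_distrib mult_smult_right mult.commute)
  qed
  then show ?thesis by (metis dvd_triv_left)
qed

lemma f_poly_step:
  assumes "n > 0"
  shows "f_poly n j = [:1, -1:] * f_poly n (Suc j) + smult (poly (f_poly n j) 1 / of_nat n) (Psi n)"
proof -
  define g where "g = smult (- 1 / of_nat n) ([:0, 1:] * pderiv (Psi n))"
  have f_eq: "f_poly n j = (if j = 0 then 1 else g ^ j mod Psi n)" for j
    unfolding f_poly_def g_def ..
  have f: "[f_poly n j = g ^ j] (mod Psi n)" for j
    by (simp add: f_eq cong_def)
  have inv: "[[:1, -1:] * g = 1] (mod Psi n)"
    using linear_inverse_mod_Psi[OF assms] by (simp add: cong_iff_dvd_diff g_def)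
  have "[[:1, -1:] * f_poly n (Suc j) = [:1, -1:] * g ^ Suc j] (mod Psi n)"
    by (intro cong_mult cong_refl f)
  also have "[:1, -1:] * g ^ Suc j = ([:1, -1:] * g) * g ^ j"
    by (simp only: power_Suc mult.assoc)
  also have "[\<dots> = 1 * g ^ j] (mod Psi n)"
    by (intro cong_mult cong_refl inv)
  also have "[1 * g ^ j = f_poly n j] (mod Psi n)"
    using f[of j] by (simp add: cong_sym)
  finally have "Psi n dvd f_poly n j - [:1, -1:] * f_poly n (Suc j)"
    by (metis cong_iff_dvd_diff cong_sym)
  then obtain q where q: "f_poly n j - [:1, -1:] * f_poly n (Suc j) = Psi n * q" ..
  \<comment> \<open>The bound cannot be strict: \<open>f_poly n 0\<close> is 1 rather than a
    remainder, and for \<open>n = 1\<close> the modulus is constant. At \<open>Suc j\<close> there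
    is a genuine remainder, which leaves room for the linear factor in \<open>deg'\<close>.\<close>
  have deg: "degree (f_poly n i) \<le> n - 1" for i
    using degree_mod_less[OF Psi_neq_0[OF assms], of "g ^ i"]
    by (auto simp: f_eq degree_Psi)
  have deg': "degree ([:1, -1:] * f_poly n (Suc j)) \<le> n - 1"
  proof (cases "f_poly n (Suc j) = 0")
    case False
    then have "degree (f_poly n (Suc j)) < n - 1"
      using degree_mod_less[OF Psi_neq_0[OF assms], of "g ^ Suc j"]
      by (auto simp: f_eq degree_Psi)
    then show ?thesis
      by (intro order_trans[OF degree_mult_le]) simp
  qed simp
  have "degree (Psi n * q) \<le> n - 1"
    unfolding q[symmetric] by (intro degree_diff_le deg deg')
  then have "degree q = 0"
    using Psi_neq_0[OF assms] by (cases "q = 0") (auto simp: degree_mult_eq degree_Psi)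
  then obtain c where c: "q = [:c:]"
    by (metis degree_eq_zeroE)
  have "poly (f_poly n j) 1 = of_nat n * c"
    using arg_cong[OF q, of "\<lambda>r. poly r 1"] by (simp add: c poly_Psi_1)
  then show ?thesis
    using q assms by (simp add: c poly_Psi_1 algebra_simps)
qed

text \<open>Iterating \<open>f_poly_step\<close> and dividing by $\Psi_n$ gives the expansion of $1/\Psi_n$ in powers of
  $1-x$, with coefficients $f^{(n)}_j(1)/n$.\<close>

lemma fps_expansion_unique:
  fixes F :: "nat \<Rightarrow> 'a::comm_ring_1 fps"
  assumes "\<And>j. F j = fps_X * F (Suc j) + fps_const (c j) * P"
  shows "F 0 = P * Abs_fps c"
proof -
  \<comment> \<open>The claim is generalised to all \<open>j\<close> with the shifted sequence of
    constants: the coefficient of \<open>F j\<close> at \<open>Suc n\<close> is reduced to that of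
    \<open>F (Suc j)\<close> at \<open>n\<close>.\<close>
  have "F j $ n = (P * Abs_fps (\<lambda>i. c (j + i))) $ n" for j n
  proof (induction n arbitrary: j)
    case 0
    show ?case by (subst assms) (simp add: mult.commute)
  next
    case (Suc n)
    have shift: "Abs_fps (\<lambda>i. c (j + i)) = fps_const (c j) + fps_X * Abs_fps (\<lambda>i. c (Suc j + i))"
      by (rule fps_ext) (auto simp: gr0_conv_Suc)
    have "F j $ Suc n = F (Suc j) $ n + c j * P $ Suc n"
      by (subst assms) simp
    also have "\<dots> = (fps_X * (P * Abs_fps (\<lambda>i. c (Suc j + i))) + fps_const (c j) * P) $ Suc n"
      by (simp add: Suc.IH)
    also have "\<dots> = (P * Abs_fps (\<lambda>i. c (j + i))) $ Suc n"
      unfolding shift by (simp only: algebra_simps)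
    finally show ?case .
  qed
  from this[of 0] show ?thesis by (simp add: fps_eq_iff)
qed

definition flip_poly :: "'a::comm_ring_1 poly \<Rightarrow> 'a poly" where
  "flip_poly q = pcompose q [:1, -1:]"

lemma flip_poly_linear: "flip_poly [:1, -1:] = [:0, 1:]"
  by (simp add: flip_poly_def pcompose_pCons)

text \<open>In the variable $1-x$, \<open>f_poly_step\<close> is the recursion of
  \<open>fps_expansion_unique\<close>, and its starting term is 1 because $f_0 = 1$.\<close>

lemma Psi_fps_inverse:
  assumes "n > 0"
  shows "fps_of_poly (flip_poly (Psi n)) * Abs_fps (\<lambda>j. poly (f_poly n j) 1 / of_nat n) = 1"
proof -
  have "fps_of_poly (flip_poly (f_poly n j)) = fps_X * fps_of_poly (flip_poly (f_poly n (Suc j))) +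
      fps_const (poly (f_poly n j) 1 / of_nat n) * fps_of_poly (flip_poly (Psi n))" for j
  proof -
    have "flip_poly (f_poly n j) = [:0, 1:] * flip_poly (f_poly n (Suc j)) +
        smult (poly (f_poly n j) 1 / of_nat n) (flip_poly (Psi n))"
      by (subst f_poly_step[OF assms])
         (simp only: flip_poly_def pcompose_add pcompose_mult pcompose_smult flip_poly_linear[unfolded flip_poly_def])
    then show ?thesis
      by (simp only: fps_of_poly_add fps_of_poly_mult fps_of_poly_smult fps_of_poly_fps_X)
  qed
  from fps_expansion_unique[where F = "\<lambda>j. fps_of_poly (flip_poly (f_poly n j))", OF this]
  show ?thesis by (simp add: f_poly_def flip_poly_def pcompose_1)
qed

lemma c_coeff_fps:
  assumes "\<And>l. l \<in> {1..k} \<Longrightarrow> ns l > 0"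
  shows "fps_of_poly (flip_poly (\<Prod>l = 1..k. Psi (ns l))) * Abs_fps (c_coeff p k ns) = fps_of_poly (flip_poly p)"
proof -
  let ?b = "\<lambda>l. Abs_fps (\<lambda>j. poly (f_poly (ns l) j) 1 / of_nat (ns l))"
  have "Abs_fps (c_coeff p k ns) = fps_of_poly (flip_poly p) * (\<Prod>l = 1..k. ?b l)"
    by (rule fps_ext)
       (simp add: coeff_fps_prod_compositions c_coeff_def prod_dividef sum_divide_distrib
          case_prod_unfold a_coeff_def flip_poly_def del: One_nat_def)
  moreover have "fps_of_poly (flip_poly (\<Prod>l = 1..k. Psi (ns l))) * (\<Prod>l = 1..k. ?b l) = 1"
    using assms
    by (simp add: flip_poly_def pcompose_prod fps_of_poly_prod flip: prod.distrib)
       (simp add: Psi_fps_inverse flip: flip_poly_def)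
  ultimately show ?thesis
    by (simp only: mult.left_commute[of _ "fps_of_poly (flip_poly p)"] mult_1_right)
qed

section \<open>Values of poly at negative integers\<close>

lemma poly_binomial_poly_neg:
  "poly (binomial_poly q) (- of_nat (Suc m)) = (- 1) ^ q * of_nat (m choose q)"
proof -
  have "poly (binomial_poly q) (- of_nat (Suc m)) = (\<Prod>i = 1..q. of_nat i - of_nat (Suc m)) / fact q"
    by (simp add: binomial_poly_def poly_prod algebra_simps)
  also have "(\<Prod>i = 1..q. of_nat i - of_nat (Suc m)) = (\<Prod>i = 0..<q. (- 1) * (of_nat m - of_nat i :: rat))"
    by (rule prod.reindex_bij_witness[of _ Suc "\<lambda>i. i - 1"]) auto
  also have "\<dots> = (- 1) ^ q * (fact q * (of_nat m gchoose q))"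
    by (simp add: prod.distrib gbinomial_mult_fact del: mult_minus_left minus_diff_eq mult_minus1)
  finally show ?thesis
    by (simp add: binomial_gbinomial)
qed

lemma poly_poly_part_neg:
  assumes "m + k > 0"
  shows "poly (poly_part p m k ns) (- of_nat (Suc \<nu>)) =
    (fps_of_poly ([:1, -1:] ^ \<nu>) * Abs_fps (c_coeff p k ns)) $ (m + k - 1)"
proof -
  have co: "coeff ([:1, -1:] ^ \<nu>) q = (- 1) ^ q * (of_nat (\<nu> choose q) :: rat)" for q
  proof (cases "q \<le> \<nu>")
    case False
    then show ?thesis by (simp add: coeff_eq_0)
  qed (simp add: coeff_linear_poly_power)
  have "poly (poly_part p m k ns) (- of_nat (Suc \<nu>)) =
      (\<Sum>j = 0..m + k - 1. c_coeff p k ns j * ((- 1) ^ (m + k - j - 1) * of_nat (\<nu> choose (m + k - j - 1))))"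
    unfolding poly_part_def poly_sum poly_smult poly_binomial_poly_neg ..
  also have "\<dots> = (Abs_fps (c_coeff p k ns) * fps_of_poly ([:1, -1:] ^ \<nu>)) $ (m + k - 1)"
    by (auto simp: fps_mult_nth co diff_right_commute intro!: sum.cong)
  finally show ?thesis by (simp add: mult.commute)
qed

section \<open>Residue sums and partial fractions\<close>

text \<open>The sum of the residues of $R/D$ is its coefficient at $1/z$ at infinity. The use of
  \<open>pCons 0 R\<close> covers the case of constant \<open>D\<close>.\<close>

lemma lead_coeff_mult_sum_residues:
  fixes D R :: "'a::field poly"
  assumes fin: "finite Z" and card: "card Z = degree D"
    and root: "\<And>z. z \<in> Z \<Longrightarrow> poly D z = 0"
    and simple: "\<And>z. z \<in> Z \<Longrightarrow> poly (pderiv D) z \<noteq> 0"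
    and deg: "R = 0 \<or> degree R < degree D"
  shows "lead_coeff D * (\<Sum>z\<in>Z. poly R z / poly (pderiv D) z) = coeff (pCons 0 R) (degree D)"
proof (cases "degree D")
  case 0
  then show ?thesis
    using fin card by simp
next
  case (Suc K)
  define q where "q z = synthetic_div D z" for z
  \<comment> \<open>Lagrange interpolation: \<open>q z\<close> is $D/(x-z)$, which has the value
    $D'(z)$ at $z$ and vanishes at the other points of \<open>Z\<close>. Hence \<open>P\<close>
    agrees with \<open>R\<close> on \<open>degree D\<close> points, so they are equal, and the top
    coefficients give the claim.\<close>
  define P where "P = (\<Sum>z\<in>Z. smult (poly R z / poly (pderiv D) z) (q z))"
  have D: "D = [:- z, 1:] * q z" if "z \<in> Z" for z
    using synthetic_div_correct'[of z D] root[OF that] by (simp add: q_def)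
  have degq: "degree (q z) = K" for z
    by (simp add: q_def degree_synthetic_div Suc)
  have coeffq: "coeff (q z) K = lead_coeff D" if "z \<in> Z" for z
  proof -
    have "coeff D (Suc K) = coeff ([:- z, 1:] * q z) (Suc K)"
      using D[OF that] by simp
    then show ?thesis
      by (simp add: Suc coeff_eq_0 degq)
  qed
  have diag: "poly (q z) z = poly (pderiv D) z" if "z \<in> Z" for z
  proof -
    have "pderiv D = pderiv ([:- z, 1:] * q z)"
      using D[OF that] by simp
    then show ?thesis
      by (simp only: pderiv_mult) (simp add: pderiv_pCons)
  qed
  have off: "poly (q z) w = 0" if "z \<in> Z" "w \<in> Z" "w \<noteq> z" for z w
    using arg_cong[OF D[OF that(1)], of "\<lambda>p. poly p w"] root[OF that(2)] that(3) by simp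
  have "P = R"
  proof (rule poly_eqI_degree)
    show "poly P w = poly R w" if "w \<in> Z" for w
    proof -
      have "poly P w = (\<Sum>z\<in>Z. if z = w then poly R w else 0)"
        unfolding P_def poly_sum using that
        by (intro sum.cong) (auto simp: diag off simple)
      then show ?thesis
        using fin that by simp
    qed
    have "degree P \<le> K"
      unfolding P_def by (intro degree_sum_le fin) (simp add: degq)
    then show "degree P < card Z"
      by (simp add: card Suc)
    show "degree R < card Z"
      using deg by (auto simp: card Suc)
  qed
  then have "coeff R K = (\<Sum>z\<in>Z. coeff (smult (poly R z / poly (pderiv D) z) (q z)) K)"
    by (metis P_def coeff_sum)
  then show ?thesis
    by (simp add: Suc coeffq sum_distrib_left mult_ac)
qed

text \<open>With $C$ the truncation of $H = N/D$, the difference $N - DC$ is divisible by $z^M$.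
  This splits $N/(z^M D)$ into $C/z^M$ and $R/D$. The degree bound makes the coefficient of $N$ at
  \<open>degree D + M - 1\<close> vanish, so the residue $H_{M-1}$ at 0 cancels the coefficient of
  $R/D$ at $1/z$.\<close>

lemma truncated_division:
  fixes D N :: "'a::idom poly"
  assumes H: "fps_of_poly D * H = fps_of_poly N"
    and deg: "degree N < degree D + M - 1" and "M > 0"
  obtains R where "N = D * truncate_fps M H + monom 1 M * R"
    and "R = 0 \<or> degree R < degree D"
    and "coeff (pCons 0 R) (degree D) = - lead_coeff D * H $ (M - 1)"
proof -
  from \<open>M > 0\<close> obtain L where M: "M = Suc L"
    using gr0_conv_Suc by blast
  define C where "C = truncate_fps M H"
  have degC: "degree C \<le> L"
    using degree_truncate_fps[of M H] by (simp add: C_def M)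
  have "coeff (N - D * C) i = 0" if "i < M" for i
  proof -
    have "fps_of_poly (N - D * C) = fps_of_poly D * (H - fps_cutoff M H)"
      by (simp add: fps_of_poly_diff fps_of_poly_mult C_def H right_diff_distrib)
    then have "coeff (N - D * C) i = (fps_of_poly D * (H - fps_cutoff M H)) $ i"
      by (metis fps_of_poly_nth)
    also have "\<dots> = 0"
      using that by (auto simp: fps_mult_nth intro!: sum.neutral)
    finally show ?thesis .
  qed
  then have "monom 1 M dvd N - D * C"
    by (simp add: monom_1_dvd_iff')
  then obtain R where "N - D * C = monom 1 M * R" ..
  then have N: "N = D * C + monom 1 M * R"
    by (simp add: algebra_simps)
  have deg_DC: "degree (D * C) \<le> degree D + L"
    using degC degree_mult_le[of D C] by linarith
  have "R = 0 \<or> degree R < degree D"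
  proof (rule ccontr)
    assume "\<not> (R = 0 \<or> degree R < degree D)"
    then have R: "R \<noteq> 0" "degree D \<le> degree R"
      by auto
    have "degree (monom 1 M * R) = M + degree R"
      using R by (simp add: degree_mult_eq degree_monom_eq)
    moreover have "monom 1 M * R = N - D * C"
      by (simp add: N)
    moreover have "degree (N - D * C) \<le> degree D + L"
      using deg deg_DC by (intro degree_diff_le) (auto simp: M)
    ultimately show False
      using R by (simp add: M)
  qed
  moreover have "coeff (pCons 0 R) (degree D) = - lead_coeff D * H $ (M - 1)"
  proof -
    have "0 = coeff N (degree D + L)"
      using deg by (simp add: coeff_eq_0 M)
    also have "\<dots> = coeff (D * C) (degree D + L) + coeff (monom 1 M * R) (degree D + L)"
      by (simp add: N)
    also have "coeff (D * C) (degree D + L) = lead_coeff D * coeff C L"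
    proof (cases "degree C = L")
      case True
      then show ?thesis by (metis coeff_mult_degree_sum)
    next
      case False
      with degC have "degree C < L" by simp
      then show ?thesis
        using degree_mult_le[of D C] by (simp add: coeff_eq_0)
    qed
    also have "coeff C L = H $ (M - 1)"
      by (simp add: C_def M)
    also have "coeff (monom 1 M * R) (degree D + L) = coeff (pCons 0 R) (degree D)"
      by (auto simp: coeff_monom_mult M coeff_pCons split: nat.splits)
    finally show ?thesis by (simp add: eq_neg_iff_add_eq_0 add.commute)
  qed
  ultimately show ?thesis
    using that N by (simp add: C_def)
qed

section \<open>Passage to complex coefficients and roots of unity\<close>

abbreviation cpoly :: "rat poly \<Rightarrow> complex poly" where
  "cpoly \<equiv> map_poly of_rat"

lemma cpoly_add: "cpoly (p + q) = cpoly p + cpoly q"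
  by (rule poly_eqI) (simp add: coeff_map_poly of_rat_add)

lemma cpoly_mult: "cpoly (p * q) = cpoly p * cpoly q"
  by (rule poly_eqI) (simp add: coeff_map_poly coeff_mult of_rat_sum of_rat_mult)

lemma cpoly_power: "cpoly (p ^ n) = cpoly p ^ n"
  by (induction n) (simp_all add: cpoly_mult)

lemma cpoly_flip_poly: "cpoly (flip_poly p) = flip_poly (cpoly p)"
  by (induction p)
     (simp_all add: flip_poly_def pcompose_pCons map_poly_pCons cpoly_add cpoly_mult of_rat_minus
        del: mult_pCons_left)

lemma degree_cpoly: "degree (cpoly p) = degree p"
  by (rule degree_map_poly) simp

lemma degree_flip_poly:
  fixes p :: "'a::idom poly"
  shows "degree (flip_poly p) = degree p"
  by (simp add: flip_poly_def degree_pcompose)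

lemma poly_flip_poly: "poly (flip_poly p) x = poly p (1 - x)"
  by (simp add: flip_poly_def poly_pcompose)

definition unity_roots :: "nat \<Rightarrow> complex set" where
  "unity_roots b = {\<zeta>. \<zeta> \<noteq> 1 \<and> \<zeta> ^ b = 1}"

lemma unity_roots_alt: "unity_roots b = {\<zeta>. \<zeta> ^ b = 1} - {1}"
  by (auto simp: unity_roots_def)

lemma finite_unity_roots: "b > 0 \<Longrightarrow> finite (unity_roots b)"
  using bij_betw_finite[OF bij_betw_roots_unity[of b]] by (simp add: unity_roots_alt)

lemma card_unity_roots: "b > 0 \<Longrightarrow> card (unity_roots b) = b - 1"
  by (simp add: unity_roots_alt card_Diff_singleton card_roots_unity_eq)

lemma unity_roots_disjoint:
  assumes "coprime a b"
  shows "unity_roots a \<inter> unity_roots b = {}"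
proof (cases "a = 0")
  case True
  then show ?thesis using assms by (auto simp: unity_roots_def)
next
  case False
  have "\<zeta> = 1" if "\<zeta> ^ a = 1" "\<zeta> ^ b = 1" for \<zeta> :: complex
  proof -
    obtain x y where "a * x = b * y + 1"
      using bezout_nat[OF False, of b] assms by auto
    then have "\<zeta> ^ (a * x) = \<zeta> ^ (b * y + 1)"
      by simp
    then show ?thesis
      unfolding power_add power_mult that by simp
  qed
  then show ?thesis by (auto simp: unity_roots_def)
qed

lemma fourier_dedekind_unity_roots:
  assumes "b > 0"
  shows "fourier_dedekind p m (int t) I (\<lambda>l. int (ns l)) b =
    1 / of_nat b * (\<Sum>\<zeta>\<in>unity_roots b. poly (cpoly p) \<zeta> * \<zeta> ^ t /
      ((1 - \<zeta>) ^ m * (\<Prod>l\<in>I. 1 - \<zeta> ^ ns l)))"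
proof -
  define \<xi> where "\<xi> = exp (2 * of_real pi * \<i> / of_nat b)"
  have pow: "\<xi> ^ i = cis (2 * pi * real i / real b)" for i
  proof -
    have "\<xi> = cis (2 * pi / real b)"
      by (simp add: \<xi>_def cis_conv_exp mult_ac)
    then show ?thesis by (simp add: DeMoivre mult_ac)
  qed
  have "bij_betw (\<lambda>i. \<xi> ^ i) {..<b} {z. z ^ b = 1}"
    using bij_betw_roots_unity[OF assms] by (simp add: pow)
  then have "bij_betw (\<lambda>i. \<xi> ^ i) ({..<b} - {0}) ({z. z ^ b = 1} - {\<xi> ^ 0})"
    by (rule bij_betw_DiffI) (use assms in \<open>auto simp: bij_betw_def\<close>)
  moreover have "{..<b} - {0} = {1..b - 1}"
    using assms by auto
  ultimately have bij: "bij_betw (\<lambda>i. \<xi> ^ i) {1..b - 1} (unity_roots b)"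
    by (simp add: unity_roots_alt)
  have powi: "\<xi> powi (int i * int r) = (\<xi> ^ i) ^ r" for i r
    by (metis of_nat_mult power_int_of_nat power_mult)
  show ?thesis
    unfolding fourier_dedekind_def \<xi>_def[symmetric] Let_def powi
    by (simp add: sum.reindex_bij_betw[OF bij, symmetric] del: One_nat_def)
qed

lemma linear_power_mult_flip_prod_Psi:
  "[:0, 1:] ^ k * flip_poly (\<Prod>l = 1..k. Psi (ns l)) = (\<Prod>l = 1..k. 1 - [:1, -1:] ^ ns l)"
proof -
  have pow: "flip_poly ([:0, 1:] ^ n) = [:1, -1:] ^ n" for n
    by (induction n) (simp_all add: flip_poly_def pcompose_mult pcompose_1 pcompose_pCons)
  have "flip_poly ([:1, -1:] * Psi n) = flip_poly (1 - [:0, 1:] ^ n)" for n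
    by (simp only: linear_mult_Psi)
  then have "[:0, 1:] * flip_poly (Psi n) = 1 - [:1, -1:] ^ n" for n
    by (simp only: flip_poly_def pcompose_mult pcompose_diff pcompose_1
        flip_poly_linear[unfolded flip_poly_def] pow[unfolded flip_poly_def])
  then have "(\<Prod>l = 1..k. 1 - [:1, -1:] ^ ns l) = (\<Prod>l = 1..k. [:0, 1:] * flip_poly (Psi (ns l)))"
    by simp
  also have "\<dots> = [:0, 1:] ^ k * flip_poly (\<Prod>l = 1..k. Psi (ns l))"
    by (simp only: prod.distrib flip_poly_def pcompose_prod) simp
  finally show ?thesis ..
qed

lemma cpoly_diff: "cpoly (p - q) = cpoly p - cpoly q"
  by (rule poly_eqI) (simp add: coeff_map_poly of_rat_diff)

lemma cpoly_prod: "cpoly (\<Prod>i\<in>A. f i) = (\<Prod>i\<in>A. cpoly (f i))"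
  by (induction A rule: infinite_finite_induct) (simp_all add: cpoly_mult)

context
  fixes k :: nat and ns :: "nat \<Rightarrow> nat" and D :: "complex poly"
  assumes pos: "\<And>l. l \<in> {1..k} \<Longrightarrow> ns l > 0"
    and coprime: "pairwise (\<lambda>i j. coprime (ns i) (ns j)) {1..k}"
  defines "D \<equiv> cpoly (flip_poly (\<Prod>l = 1..k. Psi (ns l)))"
begin

lemma linear_power_mult_cpoly_flip_prod_Psi: "[:0, 1:] ^ k * D = (\<Prod>l = 1..k. 1 - [:1, -1:] ^ ns l)"
proof -
  have "cpoly ([:0, 1:] ^ k * flip_poly (\<Prod>l = 1..k. Psi (ns l))) =
      cpoly (\<Prod>l = 1..k. 1 - [:1, -1:] ^ ns l)"
    by (simp only: linear_power_mult_flip_prod_Psi)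
  then show ?thesis
    by (simp add: D_def cpoly_mult cpoly_power cpoly_prod cpoly_diff map_poly_pCons of_rat_minus)
qed

lemma degree_flip_prod_Psi: "degree D = (\<Sum>l = 1..k. ns l - 1)"
  using pos by (simp add: D_def degree_cpoly degree_flip_poly degree_prod_eq_sum_degree Psi_neq_0 degree_Psi)

lemma prod_one_minus_power_neq_0:
  assumes "j \<in> {1..k}" "\<zeta> \<in> unity_roots (ns j)"
  shows "(\<Prod>l\<in>{1..k} - {j}. 1 - \<zeta> ^ ns l) \<noteq> 0"
proof -
  have "\<zeta> ^ ns l \<noteq> 1" if "l \<in> {1..k} - {j}" for l
    using unity_roots_disjoint[of "ns j" "ns l"] coprime assms that
    by (auto simp: pairwise_def unity_roots_def)
  then show ?thesis
    by auto
qed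

lemma flip_prod_Psi_root:
  assumes "j \<in> {1..k}" "\<zeta> \<in> unity_roots (ns j)"
  shows "poly D (1 - \<zeta>) = 0"
proof -
  have "poly ([:0, 1:] ^ k * D) (1 - \<zeta>) = (\<Prod>l = 1..k. 1 - \<zeta> ^ ns l)"
    by (simp only: linear_power_mult_cpoly_flip_prod_Psi) (simp add: poly_prod)
  also have "\<dots> = 0"
    using assms by (auto simp: unity_roots_def)
  finally show ?thesis
    using assms by (auto simp: unity_roots_def)
qed

lemma flip_prod_Psi_deriv:
  assumes j: "j \<in> {1..k}" and \<zeta>: "\<zeta> \<in> unity_roots (ns j)"
  shows "(1 - \<zeta>) ^ k * poly (pderiv D) (1 - \<zeta>) =
    of_nat (ns j) * \<zeta> ^ (ns j - 1) * (\<Prod>l\<in>{1..k} - {j}. 1 - \<zeta> ^ ns l)"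
proof -
  let ?f = "\<lambda>l. 1 - [:1, -1:] ^ ns l :: complex poly"
  have "poly (pderiv ([:0, 1:] ^ k * D)) (1 - \<zeta>) = (1 - \<zeta>) ^ k * poly (pderiv D) (1 - \<zeta>)"
    using flip_prod_Psi_root[OF assms] by (simp add: pderiv_mult)
  moreover have "poly (pderiv (\<Prod>l = 1..k. ?f l)) (1 - \<zeta>) =
      (\<Sum>i = 1..k. (\<Prod>l\<in>{1..k} - {i}. 1 - \<zeta> ^ ns l) * poly (pderiv (?f i)) (1 - \<zeta>))"
    by (simp add: pderiv_prod poly_sum poly_prod)
  moreover have "\<dots> = (\<Sum>i = 1..k. if i = j then
      (\<Prod>l\<in>{1..k} - {j}. 1 - \<zeta> ^ ns l) * poly (pderiv (?f j)) (1 - \<zeta>) else 0)"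
  proof (intro sum.cong refl)
    fix i assume "i \<in> {1..k}"
    have "(\<Prod>l\<in>{1..k} - {i}. 1 - \<zeta> ^ ns l) = 0" if "i \<noteq> j"
      using that j \<zeta> by (intro prod_zero) (auto simp: unity_roots_def intro!: bexI[of _ j])
    then show "(\<Prod>l\<in>{1..k} - {i}. 1 - \<zeta> ^ ns l) * poly (pderiv (?f i)) (1 - \<zeta>) = (if i = j then
      (\<Prod>l\<in>{1..k} - {j}. 1 - \<zeta> ^ ns l) * poly (pderiv (?f j)) (1 - \<zeta>) else 0)"
      by simp
  qed
  moreover have "\<dots> = (\<Prod>l\<in>{1..k} - {j}. 1 - \<zeta> ^ ns l) * poly (pderiv (?f j)) (1 - \<zeta>)"
    using j by simp
  moreover have "poly (pderiv (?f j)) (1 - \<zeta>) = of_nat (ns j) * \<zeta> ^ (ns j - 1)"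
    using pos[OF j] by (simp add: pderiv_diff pderiv_power pderiv_pCons)
  ultimately have "(1 - \<zeta>) ^ k * poly (pderiv D) (1 - \<zeta>) =
      (\<Prod>l\<in>{1..k} - {j}. 1 - \<zeta> ^ ns l) * (of_nat (ns j) * \<zeta> ^ (ns j - 1))"
    unfolding linear_power_mult_cpoly_flip_prod_Psi by (simp only:)
  then show ?thesis
    by (simp only: mult.commute)
qed

lemma flip_prod_Psi_deriv_neq_0:
  assumes "j \<in> {1..k}" "\<zeta> \<in> unity_roots (ns j)"
  shows "poly (pderiv D) (1 - \<zeta>) \<noteq> 0"
proof -
  have "\<zeta> \<noteq> 0"
    using assms pos[of j] by (auto simp: unity_roots_def power_0_left)
  then have "(1 - \<zeta>) ^ k * poly (pderiv D) (1 - \<zeta>) \<noteq> 0"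
    unfolding flip_prod_Psi_deriv[OF assms] using pos[of j] prod_one_minus_power_neq_0[OF assms] assms by simp
  then show ?thesis by simp
qed

lemma sum_unity_roots_residues:
  assumes deg: "R = 0 \<or> degree R < degree D"
  shows "lead_coeff D * (\<Sum>j = 1..k. \<Sum>\<zeta>\<in>unity_roots (ns j). poly R (1 - \<zeta>) / poly (pderiv D) (1 - \<zeta>)) =
    coeff (pCons 0 R) (degree D)"
proof -
  let ?U = "\<Union>j\<in>{1..k}. unity_roots (ns j)"
  have disj: "\<forall>i\<in>{1..k}. \<forall>j\<in>{1..k}. i \<noteq> j \<longrightarrow> unity_roots (ns i) \<inter> unity_roots (ns j) = {}"
    using coprime unity_roots_disjoint by (meson pairwise_def)
  have fin: "\<forall>j\<in>{1..k}. finite (unity_roots (ns j))"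
    using pos finite_unity_roots by blast
  have inj: "inj_on (\<lambda>\<zeta>. 1 - \<zeta>) ?U"
    by (simp add: inj_on_def)
  have "lead_coeff D * (\<Sum>z\<in>(\<lambda>\<zeta>. 1 - \<zeta>) ` ?U. poly R z / poly (pderiv D) z) = coeff (pCons 0 R) (degree D)"
  proof (rule lead_coeff_mult_sum_residues)
    have "card ?U = (\<Sum>j = 1..k. card (unity_roots (ns j)))"
      using fin disj by (intro card_UN_disjoint) auto
    then show "card ((\<lambda>\<zeta>. 1 - \<zeta>) ` ?U) = degree D"
      using pos by (simp add: card_image[OF inj] card_unity_roots degree_flip_prod_Psi del: One_nat_def)
  qed (use fin deg flip_prod_Psi_root flip_prod_Psi_deriv_neq_0 in auto)
  also have "(\<Sum>z\<in>(\<lambda>\<zeta>. 1 - \<zeta>) ` ?U. poly R z / poly (pderiv D) z) =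
      (\<Sum>\<zeta>\<in>?U. poly R (1 - \<zeta>) / poly (pderiv D) (1 - \<zeta>))"
    by (rule sum.reindex[OF inj, unfolded o_def])
  also have "\<dots> = (\<Sum>j = 1..k. \<Sum>\<zeta>\<in>unity_roots (ns j). poly R (1 - \<zeta>) / poly (pderiv D) (1 - \<zeta>))"
    using fin disj by (intro sum.UNION_disjoint) auto
  finally show ?thesis .
qed

end

section \<open>Comparison of the residues\<close>

theorem theorem6p4:
  fixes k m s :: nat and ns :: "nat \<Rightarrow> nat" and p :: "rat poly" and n :: int
  assumes "k \<ge> 1"
    and "\<And>l. l \<in> {1..k} \<Longrightarrow> ns l > 0"
    and "pairwise (\<lambda>i j. coprime (ns i) (ns j)) {1..k}"
    and "s = (\<Sum>l = 1..k. ns l)"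
    and "p \<noteq> 0"
    and "degree p < s + m"
    and "palindromic p"
    and "1 \<le> n"
    and "n \<le> int s + int m - int (degree p) - 1"
  shows "(\<Sum>j = 1..k. fourier_dedekind p m n ({1..k} - {j}) (\<lambda>l. int (ns l)) (ns j))
         = - of_rat (poly (poly_part p m k ns) (- of_int n))"
proof -
  define \<nu> where "\<nu> = nat (n - 1)"
  define D where "D = flip_poly (\<Prod>l = 1..k. Psi (ns l))"
  define H where "H = fps_of_poly ([:1, -1:] ^ \<nu>) * Abs_fps (c_coeff p k ns)"
  define N where "N = [:1, -1:] ^ \<nu> * flip_poly p"
  note pos = assms(2) and coprime = assms(3)
  have n: "n = int (Suc \<nu>)"
    using assms(8) by (simp add: \<nu>_def)
  have degD: "degree D = (\<Sum>l = 1..k. ns l - 1)"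
    using degree_flip_prod_Psi[OF pos coprime] by (simp add: D_def degree_cpoly del: One_nat_def)
  have "s = (\<Sum>l = 1..k. (ns l - 1) + 1)"
    unfolding assms(4) using pos by (intro sum.cong) (auto simp: Suc_leI)
  then have s: "s = degree D + k"
    unfolding degD sum.distrib by simp
  have "flip_poly p \<noteq> 0"
    using assms(5) by (simp add: flip_poly_def pcompose_eq_0_iff)
  then have "degree N = \<nu> + degree p"
    by (simp add: N_def degree_mult_eq degree_flip_poly)
  then have degN: "degree N < degree D + (m + k) - 1"
    using assms(1,9) by (simp add: n s)
  have "fps_of_poly D * H = fps_of_poly N"
    using c_coeff_fps[OF pos, where p = p]
    by (simp add: H_def D_def N_def fps_of_poly_mult mult_ac del: One_nat_def)
  then obtain R where N: "N = D * truncate_fps (m + k) H + monom 1 (m + k) * R"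
    and degR: "R = 0 \<or> degree R < degree D"
    and R: "coeff (pCons 0 R) (degree D) = - lead_coeff D * H $ (m + k - 1)"
    using truncated_division[of D H N "m + k"] degN assms(1) by auto
  have H: "H $ (m + k - 1) = poly (poly_part p m k ns) (- of_int n)"
    using poly_poly_part_neg[of m k p ns \<nu>] assms(1) by (simp add: H_def n)
  have term_eq: "poly (cpoly R) (1 - \<zeta>) / poly (pderiv (cpoly D)) (1 - \<zeta>) =
      1 / of_nat (ns j) * (poly (cpoly p) \<zeta> * \<zeta> ^ Suc \<nu> /
        ((1 - \<zeta>) ^ m * (\<Prod>l\<in>{1..k} - {j}. 1 - \<zeta> ^ ns l)))"
    if j: "j \<in> {1..k}" and \<zeta>: "\<zeta> \<in> unity_roots (ns j)" for j \<zeta>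
  proof -
    let ?P = "\<Prod>l\<in>{1..k} - {j}. 1 - \<zeta> ^ ns l"
    have nz: "1 - \<zeta> \<noteq> 0" "\<zeta> \<noteq> 0" "ns j \<noteq> 0"
      using \<zeta> pos[OF j] by (auto simp: unity_roots_def power_0_left)
    have pow: "\<zeta> * \<zeta> ^ (ns j - 1) = 1"
      using \<zeta> nz(3) by (metis (mono_tags, lifting) mem_Collect_eq power_eq_if unity_roots_def)
    have "cpoly N = cpoly D * cpoly (truncate_fps (m + k) H) + monom 1 (m + k) * cpoly R"
      using N by (simp add: cpoly_add cpoly_mult map_poly_monom)
    then have "poly (cpoly N) (1 - \<zeta>) = (1 - \<zeta>) ^ (m + k) * poly (cpoly R) (1 - \<zeta>)"
      using flip_prod_Psi_root[OF pos coprime j \<zeta>] by (simp add: D_def poly_monom del: One_nat_def)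
    also have "poly (cpoly N) (1 - \<zeta>) = \<zeta> ^ \<nu> * poly (cpoly p) \<zeta>"
      by (simp add: N_def cpoly_mult cpoly_power cpoly_flip_poly poly_flip_poly map_poly_pCons of_rat_minus)
    finally have 1: "(1 - \<zeta>) ^ m * (1 - \<zeta>) ^ k * poly (cpoly R) (1 - \<zeta>) = \<zeta> ^ \<nu> * poly (cpoly p) \<zeta>"
      by (simp add: power_add)
    have 2: "(1 - \<zeta>) ^ k * poly (pderiv (cpoly D)) (1 - \<zeta>) = of_nat (ns j) * \<zeta> ^ (ns j - 1) * ?P"
      using flip_prod_Psi_deriv[OF pos coprime j \<zeta>] by (simp add: D_def)
    have "poly (cpoly R) (1 - \<zeta>) / poly (pderiv (cpoly D)) (1 - \<zeta>) =
        ((1 - \<zeta>) ^ m * (1 - \<zeta>) ^ k * poly (cpoly R) (1 - \<zeta>)) /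
        ((1 - \<zeta>) ^ m * ((1 - \<zeta>) ^ k * poly (pderiv (cpoly D)) (1 - \<zeta>)))"
      using nz by simp
    also have "\<dots> = (\<zeta> * (\<zeta> ^ \<nu> * poly (cpoly p) \<zeta>)) /
        (\<zeta> * ((1 - \<zeta>) ^ m * (of_nat (ns j) * \<zeta> ^ (ns j - 1) * ?P)))"
      unfolding 1 2 using nz by simp
    also have "\<zeta> * ((1 - \<zeta>) ^ m * (of_nat (ns j) * \<zeta> ^ (ns j - 1) * ?P)) =
        (\<zeta> * \<zeta> ^ (ns j - 1)) * ((1 - \<zeta>) ^ m * (of_nat (ns j) * ?P))"
      by (simp only: mult_ac)
    finally show ?thesis
      unfolding pow by (simp add: mult_ac)
  qed
  have "(\<Sum>j = 1..k. fourier_dedekind p m n ({1..k} - {j}) (\<lambda>l. int (ns l)) (ns j)) =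
      (\<Sum>j = 1..k. \<Sum>\<zeta>\<in>unity_roots (ns j). poly (cpoly R) (1 - \<zeta>) / poly (pderiv (cpoly D)) (1 - \<zeta>))"
    unfolding n using pos
    by (intro sum.cong refl) (simp only: fourier_dedekind_unity_roots sum_distrib_left term_eq cong: sum.cong)
  also have "\<dots> = - of_rat (H $ (m + k - 1))"
  proof -
    have "lead_coeff (cpoly D) * (\<Sum>j = 1..k. \<Sum>\<zeta>\<in>unity_roots (ns j).
        poly (cpoly R) (1 - \<zeta>) / poly (pderiv (cpoly D)) (1 - \<zeta>)) = coeff (pCons 0 (cpoly R)) (degree D)"
      using sum_unity_roots_residues[OF pos coprime, of "cpoly R"] degR
      by (auto simp: D_def degree_cpoly simp del: One_nat_def)
    also have "\<dots> = of_rat (coeff (pCons 0 R) (degree D))"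
      by (simp add: coeff_pCons coeff_map_poly split: nat.splits)
    also have "\<dots> = lead_coeff (cpoly D) * - of_rat (H $ (m + k - 1))"
      unfolding R by (simp add: degree_cpoly coeff_map_poly of_rat_mult of_rat_minus)
    finally have scaled: "lead_coeff (cpoly D) * (\<Sum>j = 1..k. \<Sum>\<zeta>\<in>unity_roots (ns j).
        poly (cpoly R) (1 - \<zeta>) / poly (pderiv (cpoly D)) (1 - \<zeta>)) =
        lead_coeff (cpoly D) * - of_rat (H $ (m + k - 1))" .
    have "(\<Prod>l = 1..k. Psi (ns l)) \<noteq> 0"
      using pos Psi_neq_0 by simp
    then have "lead_coeff (cpoly D) \<noteq> 0"
      by (simp add: D_def degree_cpoly coeff_map_poly flip_poly_def pcompose_eq_0_iff)
    from mult_left_cancel[OF this, THEN iffD1, OF scaled] show ?thesis .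
  qed
  finally show ?thesis
    unfolding H .
qed

end
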